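(* Let $S$ be a commutative semigroup, $G,H$ commutative groups, and $\mathbb{K}$ a field extension of $\mathbb{Q}$. Let $f,g:S\to\mathbb{K}$, $\mathfrak{f}:S\to G$ and $\mathfrak{g}:G\to H$ be polynomial functions. Assume also that multiplication by $(\deg\mathfrak{f})!$ is bijective on $G$ and that multiplication by $(\deg\mathfrak{g})!$ is bijective on $H$. Then $f\cdot g$ and $\mathfrak{g}\circ\mathfrak{f}$ are polynomial functions. Furthermore, $$\deg(f\cdot g)\le\deg(f)+\deg(g)$$ and $$\deg(\mathfrak{g}\circ\mathfrak{f})\le\deg\mathfrak{g}\cdot\deg\mathfrak{f}.$$
   Context: A semigroup is a set with an associative binary operation (no identity required). For a commutative semigroup $T$ (in particular a commutative group), a commutative group $L$, $h\in T$ and $u:T\to L$, put $(\Delta_hu)(x)=u(x+h)-u(x)$. For an integer $m\ge0$, $u:T\to L$ is a polynomial function of degree at most $m$ if $\Delta_{h_1}\Delta_{h_2}\cdots\Delta_{h_{m+1}}u(x)=0$ for all $h_1,\dots,h_{m+1},x\in T$; $u$ is a polynomial function if this holds for some $m\geq 0$, and $\deg u$ is the smallest such $m$. For functions with values in $\mathbb{K}$, $L$ is the additive group of $\mathbb{K}$ and $f\cdot g$ is the pointwise product. Multiplication by a positive integer $k$ on a commutative group is the map $y\mapsto k\,y$. *)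

theory Defs
  imports Complex_Main
begin

definition fwd_diff :: "'a::ab_semigroup_add \<Rightarrow> ('a \<Rightarrow> 'b::ab_group_add) \<Rightarrow> 'a \<Rightarrow> 'b" where
  "fwd_diff h u = (\<lambda>x. u (x + h) - u x)"

(* For hs = [h_1, ..., h_(m+1)], the fold is
   fwd_diff h_1 (fwd_diff h_2 (... (fwd_diff h_(m+1) u))). *)
definition poly_fun_deg_le :: "nat \<Rightarrow> ('a::ab_semigroup_add \<Rightarrow> 'b::ab_group_add) \<Rightarrow> bool" where
  "poly_fun_deg_le m u \<longleftrightarrow> (\<forall>hs x. length hs = m + 1 \<longrightarrow> foldr fwd_diff hs u x = 0)"

definition poly_fun :: "('a::ab_semigroup_add \<Rightarrow> 'b::ab_group_add) \<Rightarrow> bool" where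
  "poly_fun u \<longleftrightarrow> (\<exists>m. poly_fun_deg_le m u)"

(* Only meaningful under poly_fun u. Constants, including 0, have degree 0. *)
definition poly_fun_deg :: "('a::ab_semigroup_add \<Rightarrow> 'b::ab_group_add) \<Rightarrow> nat" where
  "poly_fun_deg u = (LEAST m. poly_fun_deg_le m u)"

definition nat_mult :: "nat \<Rightarrow> 'a::ab_group_add \<Rightarrow> 'a" where
  "nat_mult k y = (\<Sum>i<k. y)"

end

theory Submission
  imports Defs
begin

text \<open>
  The product bound is the Leibniz rule
  \<open>\<Delta>\<^sub>h (f g) x = f (x + h) \<Delta>\<^sub>h g x + \<Delta>\<^sub>h f x g x\<close>, applied inductively.

  For the composition let \<open>d \<ge> 1\<close> bound the degree of the inner function \<open>u\<close>. The idea is to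
  pass from functions of \<open>x\<close> to functions \<open>\<Phi> x y\<close> of two variables, and to give them a weight
  in which a difference in \<open>x\<close> costs \<open>1\<close> and a difference in \<open>y\<close> costs \<open>d\<close>. An outer function
  of degree \<open>e\<close>, regarded as constant in \<open>x\<close>, then has weight at most \<open>e * d\<close>. On the other hand
  substituting \<open>y = u x\<close> turns weight into degree, since with \<open>v = \<Delta>\<^sub>h u\<close>
  \<open>\<Phi> (x + h) (u (x + h)) - \<Phi> x (u x)
    = (\<Phi> (x + h) - \<Phi> x) (u (x + h)) + (\<Delta>\<^bsub>v x\<^esub> (\<Phi> x)) (u x)\<close>,
  and both summands arise from functions of smaller weight. For the first this is the definition.
  For the second it is the crucial lemma \<open>weighted_diff_along\<close>: a difference in \<open>y\<close> whose
  step \<open>v x\<close> depends polynomially on \<open>x\<close>, with degree \<open>k \<le> d\<close>, still lowers the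
  weight by \<open>d - k\<close>; here \<open>k = d - 1\<close>.
\<close>

section \<open>Functions annihilated by iterated differences\<close>

text \<open>
  This is degree less than \<open>n\<close>. Counting the differences rather than the degree gives the zero
  function its own level \<open>n = 0\<close>, so that inductions can start there.
\<close>

definition vanishes_after :: "nat \<Rightarrow> ('a::ab_semigroup_add \<Rightarrow> 'b::ab_group_add) \<Rightarrow> bool" where
  "vanishes_after n u \<longleftrightarrow> (\<forall>hs x. length hs = n \<longrightarrow> foldr fwd_diff hs u x = 0)"

lemma poly_fun_deg_le_iff_vanishes_after: "poly_fun_deg_le m u \<longleftrightarrow> vanishes_after (Suc m) u"
  by (simp add: poly_fun_deg_le_def vanishes_after_def)

lemma vanishes_after_0_iff: "vanishes_after 0 u \<longleftrightarrow> (\<forall>x. u x = 0)"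
  by (simp add: vanishes_after_def)

text \<open>Splitting off the innermost difference makes induction on \<open>n\<close> possible.\<close>

lemma vanishes_after_Suc_iff: "vanishes_after (Suc n) u \<longleftrightarrow> (\<forall>h. vanishes_after n (fwd_diff h u))"
proof
  assume u: "vanishes_after (Suc n) u"
  show "\<forall>h. vanishes_after n (fwd_diff h u)"
    unfolding vanishes_after_def
  proof (intro allI impI)
    fix h hs x
    assume "length (hs :: 'a list) = n"
    then have "foldr fwd_diff (hs @ [h]) u x = 0"
      using u unfolding vanishes_after_def by (metis length_append_singleton)
    then show "foldr fwd_diff hs (fwd_diff h u) x = 0"
      by simp
  qed
next
  assume u: "\<forall>h. vanishes_after n (fwd_diff h u)"
  show "vanishes_after (Suc n) u"
    unfolding vanishes_after_def
  proof (intro allI impI)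
    fix hs x
    assume "length (hs :: 'a list) = Suc n"
    then obtain ks h where "hs = ks @ [h]" "length ks = n"
      by (metis length_Suc_conv_rev)
    then show "foldr fwd_diff hs u x = 0"
      using u unfolding vanishes_after_def by simp
  qed
qed

lemma vanishes_after_Suc:
  assumes "vanishes_after n u"
  shows "vanishes_after (Suc n) u"
  using assms by (auto simp: vanishes_after_def length_Suc_conv fwd_diff_def)

lemma vanishes_after_mono:
  assumes "vanishes_after n u" "n \<le> m"
  shows "vanishes_after m u"
  using assms(2,1) by (induction rule: dec_induct) (auto intro: vanishes_after_Suc)

lemma vanishes_after_zero: "vanishes_after n (\<lambda>x. 0)"
  by (rule vanishes_after_mono[of 0]) (simp_all add: vanishes_after_0_iff)

lemma vanishes_after_add:
  assumes "vanishes_after n u" "vanishes_after n v"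
  shows "vanishes_after n (\<lambda>x. u x + v x)"
  using assms
proof (induction n arbitrary: u v)
  case 0
  then show ?case by (simp add: vanishes_after_0_iff)
next
  case (Suc n)
  have "fwd_diff h (\<lambda>x. u x + v x) = (\<lambda>x. fwd_diff h u x + fwd_diff h v x)" for h
    by (simp add: fwd_diff_def algebra_simps)
  with Suc show ?case by (simp add: vanishes_after_Suc_iff)
qed

lemma vanishes_after_shift:
  assumes "vanishes_after n u"
  shows "vanishes_after n (\<lambda>x. u (x + k))"
  using assms
proof (induction n arbitrary: u)
  case 0
  then show ?case by (simp add: vanishes_after_0_iff)
next
  case (Suc n)
  have "fwd_diff h (\<lambda>x. u (x + k)) = (\<lambda>x. fwd_diff h u (x + k))" for h
    by (simp add: fwd_diff_def ac_simps)
  with Suc show ?case by (simp add: vanishes_after_Suc_iff)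
qed

text \<open>
  A function of degree \<open>0\<close> is constant even though there need be no zero from which all points
  could be reached: any two points reach their sum.
\<close>

lemma poly_fun_deg_le_0_iff_constant: "poly_fun_deg_le 0 u \<longleftrightarrow> (\<forall>x y. u x = u y)"
proof
  assume "poly_fun_deg_le 0 u"
  then have step: "u (x + h) = u x" for x h
    by (simp add: poly_fun_deg_le_iff_vanishes_after vanishes_after_Suc_iff
        vanishes_after_0_iff fwd_diff_def)
  show "\<forall>x y. u x = u y"
    by (metis step add.commute)
next
  assume "\<forall>x y. u x = u y"
  then have "u (x + h) - u x = 0" for x h
    by (metis right_minus_eq)
  then show "poly_fun_deg_le 0 u"
    by (simp add: poly_fun_deg_le_iff_vanishes_after vanishes_after_Suc_iff
        vanishes_after_0_iff fwd_diff_def)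
qed

lemma poly_fun_deg_le_poly_fun_deg: "poly_fun u \<Longrightarrow> poly_fun_deg_le (poly_fun_deg u) u"
  unfolding poly_fun_def poly_fun_deg_def by (rule LeastI_ex)

lemma poly_fun_deg_least: "poly_fun_deg_le m u \<Longrightarrow> poly_fun_deg u \<le> m"
  unfolding poly_fun_deg_def by (rule Least_le)

section \<open>Products\<close>

text \<open>
  Each term of the Leibniz rule lowers one of the two levels by one. When a level is \<open>0\<close> the
  product is zero, so the truncated subtraction is harmless.
\<close>

lemma vanishes_after_mult:
  fixes f g :: "'s::ab_semigroup_add \<Rightarrow> 'k::ring"
  assumes "vanishes_after a f" "vanishes_after b g"
  shows "vanishes_after (a + b - 1) (\<lambda>x. f x * g x)"
  using assms
proof (induction "a + b" arbitrary: a b f g rule: less_induct)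
  case less
  show ?case
  proof (cases "a = 0 \<or> b = 0")
    case True
    with less.prems have "(\<lambda>x. f x * g x) = (\<lambda>x. 0)"
      by (auto simp: vanishes_after_0_iff)
    then show ?thesis by (simp add: vanishes_after_zero)
  next
    case False
    then obtain a' b' where ab: "a = Suc a'" "b = Suc b'"
      by (metis not0_implies_Suc)
    have "vanishes_after (a' + b') (fwd_diff h (\<lambda>x. f x * g x))" for h
    proof -
      have df: "vanishes_after a' (fwd_diff h f)" and dg: "vanishes_after b' (fwd_diff h g)"
        using less.prems by (simp_all add: ab vanishes_after_Suc_iff)
      have "vanishes_after (a + b' - 1) (\<lambda>x. f (x + h) * fwd_diff h g x)"
        by (rule less.hyps) (use ab less.prems dg in \<open>auto intro: vanishes_after_shift\<close>)
      moreover have "vanishes_after (a' + b - 1) (\<lambda>x. fwd_diff h f x * g x)"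
        by (rule less.hyps) (use ab less.prems df in auto)
      ultimately have "vanishes_after (a' + b')
          (\<lambda>x. f (x + h) * fwd_diff h g x + fwd_diff h f x * g x)"
        by (intro vanishes_after_add) (simp_all add: ab)
      moreover have "(\<lambda>x. f (x + h) * fwd_diff h g x + fwd_diff h f x * g x)
          = fwd_diff h (\<lambda>x. f x * g x)"
        by (simp add: fwd_diff_def algebra_simps)
      ultimately show ?thesis by simp
    qed
    then show ?thesis by (simp add: ab vanishes_after_Suc_iff)
  qed
qed

section \<open>Weights of functions of two variables\<close>

text \<open>
  Weight less than \<open>n\<close>, when differences in the second variable cost \<open>d = Suc c\<close>; level \<open>0\<close> again
  means the zero function. Note that \<open>Suc n - d = n - c\<close>. The cost of a difference in the second
  variable has to be positive for the recursion to terminate, hence the parameter \<open>c\<close>.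
\<close>

fun weighted ::
  "nat \<Rightarrow> nat \<Rightarrow> ('a::ab_semigroup_add \<Rightarrow> 'b::ab_group_add \<Rightarrow> 'c::ab_group_add) \<Rightarrow> bool" where
  "weighted c 0 \<Phi> \<longleftrightarrow> (\<forall>x y. \<Phi> x y = 0)"
| "weighted c (Suc n) \<Phi> \<longleftrightarrow>
     (\<forall>h. weighted c n (\<lambda>x y. \<Phi> (x + h) y - \<Phi> x y)) \<and>
     (\<forall>a. weighted c (n - c) (\<lambda>x. fwd_diff a (\<Phi> x)))"

lemma weighted_fwd_diff:
  assumes "weighted c n \<Phi>"
  shows "weighted c (n - Suc c) (\<lambda>x. fwd_diff a (\<Phi> x))"
  using assms by (cases n) (simp_all add: fwd_diff_def)

lemma weighted_zero: "weighted c n (\<lambda>x y. 0)"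
  by (induction n rule: less_induct, case_tac x) (simp_all add: fwd_diff_def)

lemma weighted_Suc:
  assumes "weighted c n \<Phi>"
  shows "weighted c (Suc n) \<Phi>"
  using assms
proof (induction n arbitrary: \<Phi> rule: less_induct)
  case (less n)
  show ?case
  proof (cases n)
    case 0
    with less.prems have "\<Phi> = (\<lambda>x y. 0)" by auto
    then show ?thesis using weighted_zero by metis
  next
    case (Suc k)
    have "weighted c n (\<lambda>x y. \<Phi> (x + h) y - \<Phi> x y)" for h
      using less.IH[of k "\<lambda>x y. \<Phi> (x + h) y - \<Phi> x y"] less.prems Suc by simp
    moreover have "weighted c (n - c) (\<lambda>x. fwd_diff a (\<Phi> x))" for a
    proof (cases "c \<le> k")
      case True
      then show ?thesis
        using less.IH[of "k - c" "\<lambda>x. fwd_diff a (\<Phi> x)"] less.prems Suc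
        by (simp add: Suc_diff_le)
    next
      case False
      then show ?thesis using less.prems Suc by simp
    qed
    ultimately show ?thesis by simp
  qed
qed

lemma weighted_mono:
  assumes "weighted c n \<Phi>" "n \<le> m"
  shows "weighted c m \<Phi>"
  using assms(2,1) by (induction rule: dec_induct) (blast intro: weighted_Suc)+

lemma weighted_add:
  assumes "weighted c n \<Phi>" "weighted c n \<Psi>"
  shows "weighted c n (\<lambda>x y. \<Phi> x y + \<Psi> x y)"
  using assms
proof (induction n arbitrary: \<Phi> \<Psi> rule: less_induct)
  case (less n)
  show ?case
  proof (cases n)
    case 0
    with less.prems show ?thesis by simp
  next
    case (Suc k)
    have "weighted c k (\<lambda>x y. (\<Phi> (x + h) y + \<Psi> (x + h) y) - (\<Phi> x y + \<Psi> x y))" for h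
      using less.IH[of k "\<lambda>x y. \<Phi> (x + h) y - \<Phi> x y" "\<lambda>x y. \<Psi> (x + h) y - \<Psi> x y"]
        less.prems Suc by (simp add: add_diff_add)
    moreover have "weighted c (k - c) (\<lambda>x. fwd_diff a (\<lambda>y. \<Phi> x y + \<Psi> x y))" for a
      using less.IH[of "k - c" "\<lambda>x. fwd_diff a (\<Phi> x)" "\<lambda>x. fwd_diff a (\<Psi> x)"]
        less.prems Suc by (simp add: fwd_diff_def add_diff_add)
    ultimately show ?thesis by (simp add: Suc)
  qed
qed

text \<open>
  Here \<open>m\<close> is the degree of \<open>v\<close> plus one, and \<open>c + 2\<close> is the cost \<open>d\<close> of a difference in \<open>y\<close>
  plus one. For constant \<open>v\<close> it is the definition of the weight. In general a difference in \<open>x\<close>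
  of \<open>\<Delta>\<^bsub>v x\<^esub> \<Phi> x\<close> falls on \<open>\<Phi>\<close>, which lowers the weight of \<open>\<Phi>\<close>, or on \<open>v\<close>, which lowers
  the degree of \<open>v\<close> but also translates \<open>y\<close> by \<open>v x\<close>. The translation does no harm: it adds a
  further difference along \<open>v\<close>, of a function that already has smaller weight than \<open>\<Phi>\<close>.
  Hence the induction is on the weight first and on the degree of \<open>v\<close> second.
\<close>

lemma weighted_diff_along:
  assumes "weighted c n \<Phi>" "vanishes_after m v" "m \<le> c + 2"
  shows "weighted c (n + m - (c + 2)) (\<lambda>x. fwd_diff (v x) (\<Phi> x))"
  using assms
proof (induction n arbitrary: \<Phi> m v rule: less_induct)
  case (less n)
  note weight_IH = less.IH
  from less.prems show ?case
  proof (induction m arbitrary: v)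
    case 0
    then have "(\<lambda>x. fwd_diff (v x) (\<Phi> x)) = (\<lambda>x y. 0)"
      by (simp add: vanishes_after_0_iff fwd_diff_def)
    then show ?case by (simp add: weighted_zero)
  next
    case (Suc m)
    show ?case
    proof (cases "n \<le> c + 1")
      case True
      \<comment> \<open>The weight of \<open>\<Phi>\<close> is below the cost of a difference in \<open>y\<close>: \<open>\<Phi>\<close> does not depend on \<open>y\<close>.\<close>
      then have "fwd_diff a (\<Phi> x) y = 0" for a x y
        using weighted_fwd_diff[OF Suc.prems(1)] by simp
      then have "(\<lambda>x. fwd_diff (v x) (\<Phi> x)) = (\<lambda>x y. 0)"
        by (intro ext)
      then show ?thesis by (simp add: weighted_zero)
    next
      case False
      define r where "r = n + m - (c + 2)"
      have r: "n + Suc m - (c + 2) = Suc r" and "r < n"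
        using False Suc.prems(3) by (auto simp: r_def)
      have "weighted c r (\<lambda>x y. fwd_diff (v (x + h)) (\<Phi> (x + h)) y - fwd_diff (v x) (\<Phi> x) y)" for h
      proof -
        define \<Psi> where "\<Psi> = (\<lambda>x. fwd_diff (fwd_diff h v x) (\<Phi> x))"
        have \<Psi>: "weighted c r \<Psi>"
          unfolding \<Psi>_def r_def using Suc.prems
          by (intro Suc.IH) (simp_all add: vanishes_after_Suc_iff)
        have "weighted c (r + Suc m - (c + 2)) (\<lambda>x. fwd_diff (v x) (\<Psi> x))"
          by (rule weight_IH[OF \<open>r < n\<close> \<Psi> Suc.prems(2,3)])
        then have d\<Psi>: "weighted c r (\<lambda>x. fwd_diff (v x) (\<Psi> x))"
          by (rule weighted_mono) (use Suc.prems(3) in simp)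
        have "weighted c (n - 1) (\<lambda>x y. \<Phi> (x + h) y - \<Phi> x y)"
          using Suc.prems(1) False by (cases n) simp_all
        then have "weighted c (n - 1 + Suc m - (c + 2))
            (\<lambda>x. fwd_diff (v (x + h)) (\<lambda>y. \<Phi> (x + h) y - \<Phi> x y))"
          by (rule weight_IH[rotated])
            (use False Suc.prems in \<open>auto intro: vanishes_after_shift\<close>)
        then have d\<Phi>: "weighted c r (\<lambda>x. fwd_diff (v (x + h)) (\<lambda>y. \<Phi> (x + h) y - \<Phi> x y))"
          using False by (simp add: r_def)
        have "weighted c r (\<lambda>x y. fwd_diff (v (x + h)) (\<lambda>y. \<Phi> (x + h) y - \<Phi> x y) y
            + (\<Psi> x y + fwd_diff (v x) (\<Psi> x) y))"
          by (intro weighted_add d\<Phi> \<Psi> d\<Psi>)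
        moreover have "fwd_diff (v (x + h)) (\<Phi> (x + h)) y - fwd_diff (v x) (\<Phi> x) y
            = fwd_diff (v (x + h)) (\<lambda>y. \<Phi> (x + h) y - \<Phi> x y) y
              + (\<Psi> x y + fwd_diff (v x) (\<Psi> x) y)" for x y
          by (simp add: \<Psi>_def fwd_diff_def algebra_simps)
        ultimately show ?thesis by simp
      qed
      moreover have "weighted c (r - c) (\<lambda>x. fwd_diff a (fwd_diff (v x) (\<Phi> x)))" for a
      proof -
        have "weighted c (n - Suc c + Suc m - (c + 2)) (\<lambda>x. fwd_diff (v x) (fwd_diff a (\<Phi> x)))"
          by (rule weight_IH[OF _ weighted_fwd_diff[OF Suc.prems(1)] Suc.prems(2,3)])
            (use False in simp)
        moreover have "n - Suc c + Suc m - (c + 2) = r - c"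
          using False by (simp add: r_def)
        moreover have "fwd_diff (v x) (fwd_diff a (\<Phi> x)) = fwd_diff a (fwd_diff (v x) (\<Phi> x))" for x
          by (simp add: fwd_diff_def algebra_simps)
        ultimately show ?thesis by simp
      qed
      ultimately show ?thesis unfolding r by simp
    qed
  qed
qed

section \<open>Compositions\<close>

text \<open>
  A level \<open>k\<close> is degree \<open>k - 1\<close>, so the level of the weight is \<open>(k - 1) * Suc c + 1\<close>; as written, the
  expression is also right for \<open>k = 0\<close>.
\<close>

lemma weighted_of_vanishes_after:
  assumes "vanishes_after k g"
  shows "weighted c (k * Suc c - c) (\<lambda>x::'a::ab_semigroup_add. g)"
  using assms
proof (induction k arbitrary: g)
  case 0
  then show ?case by (simp add: vanishes_after_0_iff)
next
  case (Suc k)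
  have "Suc k * Suc c - c = Suc (k * Suc c)" by simp
  moreover have "weighted c (k * Suc c - c) (\<lambda>x::'a. fwd_diff a g)" for a
    using Suc.prems by (intro Suc.IH) (simp add: vanishes_after_Suc_iff)
  ultimately show ?case by (simp add: weighted_zero)
qed

text \<open>
  This is where weight becomes degree. A step \<open>h\<close> in \<open>x\<close> also moves the second argument, by
  \<open>v = \<Delta>\<^sub>h u\<close>; since \<open>v\<close> has degree less than \<open>Suc c\<close>, the resulting difference along \<open>v\<close>
  lowers the weight by one, just as the difference in \<open>x\<close> does.
\<close>

lemma vanishes_after_subst_weighted:
  assumes "weighted c n \<Phi>" "vanishes_after (c + 2) u"
  shows "vanishes_after n (\<lambda>x. \<Phi> x (u x))"
  using assms
proof (induction n arbitrary: \<Phi> u)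
  case 0
  then show ?case by (simp add: vanishes_after_0_iff)
next
  case (Suc n)
  have "vanishes_after n (fwd_diff h (\<lambda>x. \<Phi> x (u x)))" for h
  proof -
    define v where "v = fwd_diff h u"
    have "vanishes_after (c + 1) v"
      using Suc.prems(2) by (simp add: v_def vanishes_after_Suc_iff)
    from weighted_diff_along[OF Suc.prems(1) this]
    have "weighted c n (\<lambda>x. fwd_diff (v x) (\<Phi> x))" by simp
    then have "vanishes_after n (\<lambda>x. fwd_diff (v x) (\<Phi> x) (u x))"
      by (rule Suc.IH[OF _ Suc.prems(2)])
    moreover have "vanishes_after n (\<lambda>x. \<Phi> (x + h) (u (x + h)) - \<Phi> x (u (x + h)))"
      using Suc.prems
      by (intro Suc.IH[of "\<lambda>x y. \<Phi> (x + h) y - \<Phi> x y"] vanishes_after_shift) simp_all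
    ultimately have "vanishes_after n (\<lambda>x. (\<Phi> (x + h) (u (x + h)) - \<Phi> x (u (x + h)))
        + fwd_diff (v x) (\<Phi> x) (u x))"
      by (rule vanishes_after_add[rotated])
    then show ?thesis by (simp add: fwd_diff_def v_def)
  qed
  then show ?case by (simp add: vanishes_after_Suc_iff)
qed

lemma poly_fun_deg_le_mult:
  fixes f g :: "'s::ab_semigroup_add \<Rightarrow> 'k::ring"
  assumes "poly_fun_deg_le a f" "poly_fun_deg_le b g"
  shows "poly_fun_deg_le (a + b) (\<lambda>x. f x * g x)"
  using vanishes_after_mult[of "Suc a" f "Suc b" g] assms
  by (simp add: poly_fun_deg_le_iff_vanishes_after)

text \<open>Inner functions of degree \<open>0\<close> are treated apart, since the weight needs a positive cost.\<close>

lemma poly_fun_deg_le_comp: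
  fixes u :: "'a::ab_semigroup_add \<Rightarrow> 'b::ab_group_add"
  assumes "poly_fun_deg_le d u" "poly_fun_deg_le e g"
  shows "poly_fun_deg_le (e * d) (g \<circ> u)"
proof (cases d)
  case 0
  with assms(1) show ?thesis
    by (simp add: poly_fun_deg_le_0_iff_constant) metis
next
  case (Suc c)
  have "weighted c (Suc e * Suc c - c) (\<lambda>x::'a. g)"
    using assms(2) by (intro weighted_of_vanishes_after)
      (simp add: poly_fun_deg_le_iff_vanishes_after)
  moreover have "vanishes_after (c + 2) u"
    using assms(1) by (simp add: Suc poly_fun_deg_le_iff_vanishes_after)
  ultimately have "vanishes_after (Suc e * Suc c - c) (\<lambda>x. g (u x))"
    by (rule vanishes_after_subst_weighted)
  then show ?thesis
    by (simp add: Suc poly_fun_deg_le_iff_vanishes_after comp_def)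
qed

theorem theorem8:
  fixes f g :: "'s::ab_semigroup_add \<Rightarrow> 'k::field_char_0"
    and \<ff> :: "'s \<Rightarrow> 'g::ab_group_add"
    and \<gg> :: "'g \<Rightarrow> 'h::ab_group_add"
  assumes "poly_fun f" and "poly_fun g" and "poly_fun \<ff>" and "poly_fun \<gg>"
    and "bij (nat_mult (fact (poly_fun_deg \<ff>)) :: 'g \<Rightarrow> 'g)"
    and "bij (nat_mult (fact (poly_fun_deg \<gg>)) :: 'h \<Rightarrow> 'h)"
  shows "poly_fun (\<lambda>x. f x * g x) \<and> poly_fun (\<gg> \<circ> \<ff>)
    \<and> poly_fun_deg (\<lambda>x. f x * g x) \<le> poly_fun_deg f + poly_fun_deg g
    \<and> poly_fun_deg (\<gg> \<circ> \<ff>) \<le> poly_fun_deg \<gg> * poly_fun_deg \<ff>"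
proof -
  have "poly_fun_deg_le (poly_fun_deg f + poly_fun_deg g) (\<lambda>x. f x * g x)"
    by (intro poly_fun_deg_le_mult poly_fun_deg_le_poly_fun_deg assms)
  moreover have "poly_fun_deg_le (poly_fun_deg \<gg> * poly_fun_deg \<ff>) (\<gg> \<circ> \<ff>)"
    by (intro poly_fun_deg_le_comp poly_fun_deg_le_poly_fun_deg assms)
  ultimately show ?thesis
    by (auto simp: poly_fun_def intro: poly_fun_deg_least)
qed

end
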